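(* Let $G$ be a finite-dimensional $\mathbb{F}_p$-vector space, $V\le G$ a subspace, and $\beta:G\times G\to\mathbb{F}_p^r$ a bilinear map such that $\beta|_{V\times V}$ has rank at least $s$. Fix a coset $a+V$ and let $B=\{(x,y)\in(a+V)\times V:\beta(x,y)=0\}$. Let $S\le V$ be a subspace of codimension $d$ and let $k$ be a positive integer. Then \[(S\cap B_{x_1\cdot}\cap\dots\cap B_{x_k\cdot})+(S\cap B_{y_1\cdot}\cap\dots\cap B_{y_k\cdot})=S\] holds for all but at most $81p^{2d+4kr-s/4}|V|^{2k}$ choices of $(x_1,\dots,x_k,y_1,\dots,y_k)\in(a+V)^{2k}$.
   Context: For $x\in a+V$, $B_{x\cdot}=\{y\in V:(x,y)\in B\}$. A bilinear map $\gamma:V\times V\to\mathbb{F}_p^r$ has rank at least $s$ if for every nonzero $\lambda\in\mathbb{F}_p^r$ the bilinear form $\lambda\cdot\gamma$ has rank at least $s$ on $V\times V$. *)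

theory Defs
  imports "HOL-Analysis.Analysis"
begin

text \<open>Vector spaces over the finite field 'a are modelled as 'a^'n (finite index type 'n),
  with scalar multiplication (*s); subspaces and dimensions are those of the library
  interpretation vec of vector_space.\<close>

definition bilinear_map :: "('a::field ^ 'n \<Rightarrow> 'a ^ 'n \<Rightarrow> 'a ^ 'm) \<Rightarrow> bool" where
  "bilinear_map \<beta> \<longleftrightarrow>
     (\<forall>x. Vector_Spaces.linear (*s) (*s) (\<beta> x)) \<and>
     (\<forall>y. Vector_Spaces.linear (*s) (*s) (\<lambda>x. \<beta> x y))"

text \<open>The form lambda . beta.\<close>
definition lin_comb_form :: "'a::field ^ 'm \<Rightarrow> ('a ^ 'n \<Rightarrow> 'a ^ 'n \<Rightarrow> 'a ^ 'm) \<Rightarrow> 'a ^ 'n \<Rightarrow> 'a ^ 'n \<Rightarrow> 'a" where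
  "lin_comb_form l \<beta> x y = (\<Sum>i\<in>UNIV. l $ i * \<beta> x y $ i)"

text \<open>Rank of a bilinear form f on V x V: dim V minus dim of its (left) radical in V.\<close>
definition bf_rank_on :: "('a::field ^ 'n) set \<Rightarrow> ('a ^ 'n \<Rightarrow> 'a ^ 'n \<Rightarrow> 'a) \<Rightarrow> nat" where
  "bf_rank_on V f = vec.dim V - vec.dim {x\<in>V. \<forall>y\<in>V. f x y = 0}"

text \<open>beta has rank at least s on V x V: every nonzero lambda . beta has rank at least s.\<close>
definition bm_rank_ge :: "('a::field ^ 'n) set \<Rightarrow> ('a ^ 'n \<Rightarrow> 'a ^ 'n \<Rightarrow> 'a ^ 'm) \<Rightarrow> real \<Rightarrow> bool" where
  "bm_rank_ge V \<beta> s \<longleftrightarrow> (\<forall>l. l \<noteq> 0 \<longrightarrow> real (bf_rank_on V (lin_comb_form l \<beta>)) \<ge> s)"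

definition coset :: "'g::plus \<Rightarrow> 'g set \<Rightarrow> 'g set" where
  "coset a V = (\<lambda>v. a + v) ` V"

definition sect :: "('g \<times> 'g) set \<Rightarrow> 'g \<Rightarrow> 'g set" where
  "sect B x = {y. (x, y) \<in> B}"

definition setsum :: "'g::plus set \<Rightarrow> 'g set \<Rightarrow> 'g set" where
  "setsum A C = {u + v | u v. u \<in> A \<and> v \<in> C}"

end

theory Submission
  imports Defs
begin

(* If U_x = S \<inter> B_x1 \<inter> ... \<inter> B_xk and U_y = S \<inter> B_y1 \<inter> ... \<inter> B_yk do not sum to S,
   some linear functional phi on S vanishes on U_x + U_y but not on S. Vanishing on the common
   kernel of the forms beta(x_i, -) on S, phi is a combination of the lambda_i . beta(x_i, -),
   and likewise of the mu_i . beta(y_i, -), with some lambda_i0 nonzero. So every bad tuple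
   satisfies a nontrivial relation sum lambda_i . beta(x_i, -) = sum mu_i . beta(y_i, -) on S.
   For fixed (lambda, mu) and all coordinates but x_i0 fixed, the admissible x_i0 lie in a coset
   of K = {v \<in> V. lambda_i0 . beta(v, -) vanishes on S}; since S has codimension d in V,
   dim K \<le> dim V - rank (lambda_i0 . beta) + d \<le> dim V - s + d. Summing over the p^(2kr)
   choices of (lambda, mu) gives at most p^(2kr + d - s) |V|^(2k) bad tuples. *)

abbreviation linear_functional :: "('a::field ^ 'n \<Rightarrow> 'a) \<Rightarrow> bool" where
  "linear_functional \<equiv> Vector_Spaces.linear (*s) (*)"

interpretation functional:
  vector_space_pair "(*s) :: 'a::field \<Rightarrow> 'a ^ 'n \<Rightarrow> 'a ^ 'n" "(*) :: 'a \<Rightarrow> 'a \<Rightarrow> 'a" ..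

lemma linear_functionalI:
  assumes "\<And>u v. f (u + v) = f u + f v" and "\<And>c u. f (c *s u) = c * f u"
  shows "linear_functional f"
  using assms vec.vector_space_axioms vector_space_over_itself.vector_space_axioms
  by (simp add: Vector_Spaces.linear_iff)

lemma subspace_common_kernel:
  assumes "vec.subspace T" and "\<forall>i\<in>I. linear_functional (f i)"
  shows "vec.subspace {y\<in>T. \<forall>i\<in>I. f i y = 0}"
proof -
  have "{y\<in>T. \<forall>i\<in>I. f i y = 0} = T \<inter> (\<Inter>i\<in>I. {y. f i y = 0})" by auto
  then show ?thesis
    using assms by (auto intro!: vec.subspace_inter vec.subspace_Inter functional.linear_subspace_kernel)
qed

lemma linear_functional_proportional_on_kernel:
  assumes S: "vec.subspace S" and f: "linear_functional f" and g: "linear_functional g"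
    and vanish: "\<forall>y\<in>S. f y = 0 \<longrightarrow> g y = 0"
  shows "\<exists>t. \<forall>y\<in>S. g y = t * f y"
proof (cases "\<forall>y\<in>S. f y = 0")
  case True
  then show ?thesis using vanish by (intro exI[of _ 0]) auto
next
  case False
  then obtain y0 where y0: "y0 \<in> S" "f y0 \<noteq> 0" by auto
  have "g y = g y0 / f y0 * f y" if y: "y \<in> S" for y
  proof -
    let ?w = "y - (f y / f y0) *s y0"
    have "?w \<in> S" using S y y0 by (simp add: vec.subspace_diff vec.subspace_scale)
    moreover have "f ?w = 0"
      using y0 by (simp add: functional.linear_diff[OF f] functional.linear_scale[OF f])
    ultimately have "g ?w = 0" using vanish by blast
    then show ?thesis by (simp add: functional.linear_diff[OF g] functional.linear_scale[OF g])
  qed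
  then show ?thesis by blast
qed

lemma linear_functional_in_span_on_common_kernel:
  assumes "finite I" and "vec.subspace S" and "\<forall>i\<in>I. linear_functional (f i)"
    and "linear_functional g" and "\<forall>y\<in>S. (\<forall>i\<in>I. f i y = 0) \<longrightarrow> g y = 0"
  shows "\<exists>c. \<forall>y\<in>S. g y = (\<Sum>i\<in>I. c i * f i y)"
  using assms
proof (induction I arbitrary: S rule: finite_induct)
  case empty
  then show ?case by auto
next
  case (insert j I)
  let ?S' = "{y\<in>S. f j y = 0}"
  have "vec.subspace ?S'"
    using insert.prems subspace_common_kernel[of S "{j}" f] by simp
  moreover have "\<forall>y\<in>?S'. (\<forall>i\<in>I. f i y = 0) \<longrightarrow> g y = 0"
    using insert.prems by auto
  ultimately obtain c where c: "\<forall>y\<in>?S'. g y = (\<Sum>i\<in>I. c i * f i y)"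
    using insert.IH insert.prems by blast
  let ?h = "\<lambda>y. g y - (\<Sum>i\<in>I. c i * f i y)"
  have "linear_functional ?h"
    using insert.prems
    by (intro functional.linear_compose_sub functional.linear_compose_sum ballI
        functional.linear_compose_scale_right) auto
  then obtain t where t: "\<forall>y\<in>S. ?h y = t * f j y"
    using linear_functional_proportional_on_kernel[of S "f j" ?h] insert.prems c by auto
  have "g y = (\<Sum>i\<in>insert j I. (c(j := t)) i * f i y)" if "y \<in> S" for y
  proof -
    have "(\<Sum>i\<in>I. (c(j := t)) i * f i y) = (\<Sum>i\<in>I. c i * f i y)"
      using insert.hyps by (intro sum.cong) auto
    then show ?thesis using t that insert.hyps by (simp add: algebra_simps)
  qed
  then show ?case by blast
qed

lemma dim_le_dim_kernel_Suc:
  assumes T: "vec.subspace T" and f: "linear_functional f"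
  shows "vec.dim T \<le> Suc (vec.dim {y\<in>T. f y = 0})"
proof (cases "\<forall>y\<in>T. f y = 0")
  case True
  then have "{y\<in>T. f y = 0} = T" by auto
  then show ?thesis by simp
next
  case False
  then obtain t0 where t0: "t0 \<in> T" "f t0 \<noteq> 0" by auto
  let ?T0 = "{y\<in>T. f y = 0}"
  have "y \<in> vec.span (insert t0 ?T0)" if y: "y \<in> T" for y
  proof -
    let ?w = "y - (f y / f t0) *s t0"
    have "?w \<in> ?T0"
      using T y t0 by (simp add: vec.subspace_diff vec.subspace_scale
          functional.linear_diff[OF f] functional.linear_scale[OF f])
    then have "?w + (f y / f t0) *s t0 \<in> vec.span (insert t0 ?T0)"
      by (intro vec.span_add vec.span_scale vec.span_base) auto
    then show ?thesis by simp
  qed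
  then have "vec.dim T \<le> vec.dim (insert t0 ?T0)" by (intro vec.dim_mono) auto
  also have "\<dots> \<le> Suc (vec.dim ?T0)" by (simp add: vec.dim_insert)
  finally show ?thesis .
qed

lemma dim_le_dim_common_kernel_add_card:
  assumes "finite E" and "vec.subspace T" and "\<forall>e\<in>E. linear_functional (f e)"
  shows "vec.dim T \<le> vec.dim {y\<in>T. \<forall>e\<in>E. f e y = 0} + card E"
  using assms
proof (induction E rule: finite_induct)
  case empty
  then show ?case by simp
next
  case (insert e E)
  let ?T' = "{y\<in>T. \<forall>e\<in>E. f e y = 0}"
  have "vec.subspace ?T'" using insert.prems by (simp add: subspace_common_kernel)
  then have "vec.dim ?T' \<le> Suc (vec.dim {y\<in>?T'. f e y = 0})"
    using dim_le_dim_kernel_Suc insert.prems by blast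
  moreover have "{y\<in>?T'. f e y = 0} = {y\<in>T. \<forall>e'\<in>insert e E. f e' y = 0}" by auto
  ultimately show ?case using insert by simp
qed

lemma separating_linear_functional:
  assumes M: "vec.subspace M" and z: "z \<notin> M"
  shows "\<exists>\<phi>. linear_functional \<phi> \<and> \<phi> z \<noteq> 0 \<and> (\<forall>y\<in>M. \<phi> y = 0)"
proof -
  obtain B where B: "B \<subseteq> M" "vec.independent B" "vec.span B = M"
    using vec.basis_exists M by (metis subset_antisym vec.span_minimal)
  have "vec.independent (insert z B)"
    using B z by (simp add: vec.independent_insertI)
  then obtain \<phi> where \<phi>: "linear_functional \<phi>" "\<forall>x\<in>insert z B. \<phi> x = (if x = z then 1 else 0)"
    using functional.linear_independent_extend[of _ "\<lambda>x. if x = z then 1 else 0"] by blast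
  have "\<forall>x\<in>B. \<phi> x = 0" using \<phi>(2) B(1) z by auto
  then have "\<phi> y = 0" if "y \<in> M" for y
    using functional.linear_eq_0_on_span[OF \<phi>(1)] B(3) that by blast
  then show ?thesis using \<phi> by auto
qed

lemma card_subspace:
  fixes T :: "('a::{field,finite} ^ 'n) set"
  assumes T: "vec.subspace T"
  shows "card T = CARD('a) ^ vec.dim T"
proof -
  obtain B where B: "B \<subseteq> T" "vec.independent B" "vec.span B = T" "card B = vec.dim T"
    using vec.basis_exists T by (metis subset_antisym vec.span_minimal)
  have fin: "finite B" using B(2) vec.finiteI_independent by blast
  let ?h = "\<lambda>c. \<Sum>v\<in>B. c v *s v"
  have ind: "\<forall>c. (\<Sum>v\<in>B. c v *s v) = 0 \<longrightarrow> (\<forall>v\<in>B. c v = 0)"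
    using B(2) vec.independent_explicit by blast
  have inj: "inj_on ?h (B \<rightarrow>\<^sub>E UNIV)"
  proof (rule inj_onI)
    fix c c' assume c: "c \<in> B \<rightarrow>\<^sub>E UNIV" and c': "c' \<in> B \<rightarrow>\<^sub>E UNIV" and eq: "?h c = ?h c'"
    have "(\<Sum>v\<in>B. (c v - c' v) *s v) = 0"
      using eq by (simp add: vec.scale_left_diff_distrib sum_subtractf)
    then have "\<forall>v\<in>B. c v - c' v = 0"
      using ind[rule_format, of "\<lambda>v. c v - c' v"] by simp
    then show "c = c'" using c c' by (intro PiE_ext) auto
  qed
  have image: "?h ` (B \<rightarrow>\<^sub>E UNIV) = T"
  proof -
    have "?h c \<in> ?h ` (B \<rightarrow>\<^sub>E UNIV)" for c
    proof -
      have "?h c = ?h (restrict c B)" by (intro sum.cong) auto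
      then show ?thesis by (intro image_eqI[of _ _ "restrict c B"]) auto
    qed
    then have "?h ` (B \<rightarrow>\<^sub>E UNIV) = range ?h" by auto
    then show ?thesis using B(3) vec.span_finite[OF fin] by simp
  qed
  have "card T = card (B \<rightarrow>\<^sub>E (UNIV :: 'a set))"
    using card_image[OF inj] image by simp
  then show ?thesis using fin B(4) by (simp add: card_PiE)
qed

lemma card_le_card_mult_if_covered:
  fixes m :: "'b::linordered_semidom"
  assumes "finite W" and "X \<subseteq> (\<Union>w\<in>W. A w)" and "\<And>w. w \<in> W \<Longrightarrow> finite (A w)"
    and "\<And>w. w \<in> W \<Longrightarrow> of_nat (card (A w)) \<le> m"
  shows "of_nat (card X) \<le> of_nat (card W) * m"
proof -
  have "card X \<le> card (\<Union>w\<in>W. A w)" using assms(1-3) by (intro card_mono) auto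
  also have "\<dots> \<le> (\<Sum>w\<in>W. card (A w))" by (rule card_UN_le[OF assms(1)])
  finally have "of_nat (card X) \<le> (\<Sum>w\<in>W. of_nat (card (A w)) :: 'b)"
    unfolding of_nat_sum[symmetric] by (rule of_nat_mono)
  also have "\<dots> \<le> of_nat (card W) * m" using assms(4) by (rule sum_bounded_above)
  finally show ?thesis .
qed

lemma eq_list_update_if_take_drop_eq:
  assumes "i < length xs" and "length xs' = length xs"
    and "take i xs' = take i xs" and "drop (Suc i) xs' = drop (Suc i) xs"
  shows "xs' = xs[i := xs' ! i]"
  using assms id_take_nth_drop[of i xs'] by (simp add: upd_conv_take_nth_drop)

lemma card_tuples_le_by_coordinate_fibres:
  fixes E :: "('v::ab_group_add list \<times> 'w) set"
  assumes C: "finite C" and K: "finite K" and Y: "finite Y"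
    and E: "E \<subseteq> {xs. set xs \<subseteq> C \<and> length xs = k} \<times> Y" and i: "i < k"
    and fibre: "\<And>xs t ys. (xs, ys) \<in> E \<Longrightarrow> (xs[i := t], ys) \<in> E \<Longrightarrow> xs ! i - t \<in> K"
  shows "card E \<le> card C ^ (k - 1) * card K * card Y"
proof -
  define f where "f = (\<lambda>(xs :: 'v list, ys :: 'w). (take i xs @ drop (Suc i) xs, ys))"
  have finE: "finite E"
    using E C Y finite_lists_length_eq[OF C] by (auto intro: finite_subset)
  have "card {e\<in>E. f e = q} \<le> card K" for q
  proof (cases "{e\<in>E. f e = q} = {}")
    case True
    show ?thesis unfolding True by simp
  next
    case False
    then obtain xs0 ys0 where e0: "(xs0, ys0) \<in> E" "f (xs0, ys0) = q" by auto
    have fibre_eq: "xs = xs0[i := xs ! i] \<and> ys = ys0" if "(xs, ys) \<in> {e\<in>E. f e = q}" for xs ys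
    proof -
      have len: "length xs = k" "length xs0 = k" using that e0(1) E by auto
      have "take i xs @ drop (Suc i) xs = take i xs0 @ drop (Suc i) xs0" and "ys = ys0"
        using that e0(2) by (auto simp: f_def)
      moreover have "length (take i xs) = length (take i xs0)" using len by simp
      ultimately show ?thesis
        using eq_list_update_if_take_drop_eq[of i xs0 xs] len i by (simp add: append_eq_append_conv)
    qed
    have "inj_on (\<lambda>(xs, ys). xs0 ! i - xs ! i) {e\<in>E. f e = q}"
    proof (rule inj_onI)
      fix e e' assume "e \<in> {e\<in>E. f e = q}" "e' \<in> {e\<in>E. f e = q}"
        and "(\<lambda>(xs, ys). xs0 ! i - xs ! i) e = (\<lambda>(xs, ys). xs0 ! i - xs ! i) e'"
      then show "e = e'" using fibre_eq by (cases e, cases e') fastforce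
    qed
    moreover have "(\<lambda>(xs, ys). xs0 ! i - xs ! i) ` {e\<in>E. f e = q} \<subseteq> K"
      using fibre_eq fibre e0(1) by fastforce
    ultimately show ?thesis by (rule card_inj_on_le[OF _ _ K])
  qed
  then have "card E \<le> card (f ` E) * card K"
    using card_le_card_mult_if_covered[of "f ` E" E "\<lambda>q. {e\<in>E. f e = q}" "card K"] finE by auto
  also have "card (f ` E) \<le> card ({zs. set zs \<subseteq> C \<and> length zs = k - 1} \<times> Y)"
  proof (rule card_mono)
    show "finite ({zs. set zs \<subseteq> C \<and> length zs = k - 1} \<times> Y)"
      using finite_lists_length_eq[OF C] Y by simp
    show "f ` E \<subseteq> {zs. set zs \<subseteq> C \<and> length zs = k - 1} \<times> Y"
      using E i by (force simp: f_def dest: in_set_takeD in_set_dropD)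
  qed
  finally show ?thesis
    by (simp add: card_cartesian_product card_lists_length_eq[OF C] algebra_simps)
qed

definition lin_comb_tuple ::
    "('a::field ^ 'r) list \<Rightarrow> ('a ^ 'n \<Rightarrow> 'a ^ 'n \<Rightarrow> 'a ^ 'r) \<Rightarrow> ('a ^ 'n) list \<Rightarrow> 'a ^ 'n \<Rightarrow> 'a" where
  "lin_comb_tuple ls \<beta> xs y = (\<Sum>i<length xs. lin_comb_form (ls ! i) \<beta> (xs ! i) y)"

lemma linear_functional_lin_comb_form_left:
  assumes "bilinear_map \<beta>"
  shows "linear_functional (\<lambda>x. lin_comb_form l \<beta> x y)"
proof (rule linear_functionalI)
  have lin: "Vector_Spaces.linear (*s) (*s) (\<lambda>x. \<beta> x y)"
    using assms by (simp add: bilinear_map_def)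
  show "lin_comb_form l \<beta> (u + v) y = lin_comb_form l \<beta> u y + lin_comb_form l \<beta> v y" for u v
    by (simp add: lin_comb_form_def vec.linear_add[OF lin] distrib_left sum.distrib)
  show "lin_comb_form l \<beta> (c *s u) y = c * lin_comb_form l \<beta> u y" for c u
    by (simp add: lin_comb_form_def vec.linear_scale[OF lin] sum_distrib_left mult.left_commute)
qed

lemma linear_functional_lin_comb_form_right:
  assumes "bilinear_map \<beta>"
  shows "linear_functional (lin_comb_form l \<beta> x)"
proof (rule linear_functionalI)
  have lin: "Vector_Spaces.linear (*s) (*s) (\<beta> x)"
    using assms by (simp add: bilinear_map_def)
  show "lin_comb_form l \<beta> x (u + v) = lin_comb_form l \<beta> x u + lin_comb_form l \<beta> x v" for u v
    by (simp add: lin_comb_form_def vec.linear_add[OF lin] distrib_left sum.distrib)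
  show "lin_comb_form l \<beta> x (c *s u) = c * lin_comb_form l \<beta> x u" for c u
    by (simp add: lin_comb_form_def vec.linear_scale[OF lin] sum_distrib_left mult.left_commute)
qed

lemma lin_comb_tuple_list_update:
  assumes "i < length xs"
  shows "lin_comb_tuple ls \<beta> (xs[i := t]) y
    = lin_comb_tuple ls \<beta> xs y - lin_comb_form (ls ! i) \<beta> (xs ! i) y + lin_comb_form (ls ! i) \<beta> t y"
proof -
  let ?g = "\<lambda>zs j. lin_comb_form (ls ! j) \<beta> (zs ! j) y"
  have "(\<Sum>j\<in>{..<length xs} - {i}. ?g (xs[i := t]) j) = (\<Sum>j\<in>{..<length xs} - {i}. ?g xs j)"
    by (intro sum.cong) auto
  then show ?thesis
    using assms by (simp add: lin_comb_tuple_def sum.remove[of "{..<length xs}" i])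
qed

lemma lin_comb_form_diff_eq_0_if_update_eq:
  assumes \<beta>: "bilinear_map \<beta>" and i: "i < length xs"
    and eq: "lin_comb_tuple ls \<beta> (xs[i := t]) y = lin_comb_tuple ls \<beta> xs y"
  shows "lin_comb_form (ls ! i) \<beta> (xs ! i - t) y = 0"
proof -
  have "lin_comb_form (ls ! i) \<beta> (xs ! i) y = lin_comb_form (ls ! i) \<beta> t y"
    using eq unfolding lin_comb_tuple_list_update[OF i] by (simp add: algebra_simps)
  then show ?thesis
    using functional.linear_diff[OF linear_functional_lin_comb_form_left[OF \<beta>]] by simp
qed

lemma dim_left_kernel_on_subspace_le:
  fixes f :: "'a::field ^ 'n \<Rightarrow> 'a ^ 'n \<Rightarrow> 'a"
  assumes V: "vec.subspace V" and S: "vec.subspace S" and SV: "S \<subseteq> V"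
    and left: "\<And>y. linear_functional (\<lambda>x. f x y)" and right: "\<And>x. linear_functional (f x)"
  shows "vec.dim {v\<in>V. \<forall>y\<in>S. f v y = 0}
    \<le> vec.dim {v\<in>V. \<forall>y\<in>V. f v y = 0} + (vec.dim V - vec.dim S)"
proof -
  let ?K = "{v\<in>V. \<forall>y\<in>S. f v y = 0}"
  obtain BS where BS: "BS \<subseteq> S" "vec.independent BS" "S \<subseteq> vec.span BS" "card BS = vec.dim S"
    using vec.basis_exists by blast
  obtain BV where BV: "BS \<subseteq> BV" "BV \<subseteq> V" "vec.independent BV" "V \<subseteq> vec.span BV"
    using vec.maximal_independent_subset_extend[of BS V] BS SV by blast
  have "finite BV" using BV(3) vec.finiteI_independent by blast
  then have card_E: "card (BV - BS) = vec.dim V - vec.dim S"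
    using BV BS(4) vec.basis_card_eq_dim[OF BV(2) BV(4) BV(3)] by (simp add: card_Diff_subset finite_subset)
  have radical: "{v\<in>V. \<forall>y\<in>V. f v y = 0} = {v\<in>?K. \<forall>e\<in>BV - BS. f v e = 0}"
  proof (intro set_eqI iffI)
    fix v assume "v \<in> {v\<in>?K. \<forall>e\<in>BV - BS. f v e = 0}"
    then have "v \<in> V" "\<forall>b\<in>BV. f v b = 0" using BS(1) by auto
    then show "v \<in> {v\<in>V. \<forall>y\<in>V. f v y = 0}"
      using functional.linear_eq_0_on_span[OF right] BV(4) by blast
  qed (use SV BV(2) in auto)
  have "vec.subspace ?K" using subspace_common_kernel[OF V, of S "\<lambda>y x. f x y"] left by simp
  then show ?thesis
    using dim_le_dim_common_kernel_add_card[of "BV - BS" ?K "\<lambda>e v. f v e"] left \<open>finite BV\<close>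
    unfolding radical card_E by blast
qed

lemma card_left_kernel_le:
  fixes V S :: "('a::{field,finite} ^ 'n) set" and f :: "'a ^ 'n \<Rightarrow> 'a ^ 'n \<Rightarrow> 'a"
  assumes V: "vec.subspace V" and S: "vec.subspace S" and SV: "S \<subseteq> V"
    and left: "\<And>y. linear_functional (\<lambda>x. f x y)" and right: "\<And>x. linear_functional (f x)"
    and rank: "real (bf_rank_on V f) \<ge> s"
  shows "real (card {v\<in>V. \<forall>y\<in>S. f v y = 0})
    \<le> real CARD('a) powr (real (vec.dim V - vec.dim S) - s) * real (card V)"
proof -
  let ?K = "{v\<in>V. \<forall>y\<in>S. f v y = 0}" and ?R = "{v\<in>V. \<forall>y\<in>V. f v y = 0}"
  have "vec.dim ?R \<le> vec.dim V" by (intro vec.dim_subset) auto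
  then have "real (vec.dim ?K) \<le> real (vec.dim V - vec.dim S) - s + real (vec.dim V)"
    using dim_left_kernel_on_subspace_le[OF V S SV left right] rank
    by (simp add: bf_rank_on_def of_nat_diff)
  moreover have "vec.subspace ?K"
    using subspace_common_kernel[OF V, of S "\<lambda>y x. f x y"] left by simp
  ultimately have "real (card ?K) \<le> real CARD('a) powr (real (vec.dim V - vec.dim S) - s + real (vec.dim V))"
    by (simp add: card_subspace powr_realpow[symmetric] powr_mono)
  then show ?thesis
    by (simp add: powr_add card_subspace[OF V] powr_realpow)
qed

lemma vanishing_on_right_kernel_imp_lin_comb_tuple:
  fixes \<beta> :: "'a::field ^ 'n \<Rightarrow> 'a ^ 'n \<Rightarrow> 'a ^ 'r"
  assumes S: "vec.subspace S" and \<beta>: "bilinear_map \<beta>" and \<phi>: "linear_functional \<phi>"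
    and vanish: "\<forall>y\<in>S. (\<forall>x\<in>set xs. \<beta> x y = 0) \<longrightarrow> \<phi> y = 0"
  shows "\<exists>ls. length ls = length xs \<and> (\<forall>y\<in>S. \<phi> y = lin_comb_tuple ls \<beta> xs y)"
proof -
  let ?I = "{..<length xs} \<times> (UNIV :: 'r set)"
  define g where "g q y = \<beta> (xs ! fst q) y $ snd q" for q y
  have "linear_functional (g q)" for q
  proof (rule linear_functionalI)
    have lin: "Vector_Spaces.linear (*s) (*s) (\<beta> (xs ! fst q))"
      using \<beta> by (simp add: bilinear_map_def)
    show "g q (u + v) = g q u + g q v" "g q (c *s u) = c * g q u" for u v c
      by (simp_all add: g_def vec.linear_add[OF lin] vec.linear_scale[OF lin])
  qed
  moreover have "(\<forall>q\<in>?I. g q y = 0) \<longleftrightarrow> (\<forall>x\<in>set xs. \<beta> x y = 0)" for y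
    by (auto simp: g_def vec_eq_iff all_set_conv_all_nth)
  ultimately obtain c where c: "\<forall>y\<in>S. \<phi> y = (\<Sum>q\<in>?I. c q * g q y)"
    using linear_functional_in_span_on_common_kernel[of ?I S g \<phi>] S \<phi> vanish by auto
  define ls where "ls = map (\<lambda>i. \<chi> j. c (i, j)) [0..<length xs]"
  have "(\<Sum>q\<in>?I. c q * g q y) = lin_comb_tuple ls \<beta> xs y" for y
    by (simp add: lin_comb_tuple_def lin_comb_form_def ls_def g_def sum.cartesian_product case_prod_beta)
  then show ?thesis using c by (intro exI[of _ ls]) (simp add: ls_def)
qed

lemma subspace_right_kernel:
  assumes "vec.subspace S" and "bilinear_map \<beta>"
  shows "vec.subspace {y\<in>S. \<forall>x\<in>X. \<beta> x y = 0}"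
proof -
  have "vec.subspace {y. \<beta> x y = 0}" for x
    using assms(2) unfolding bilinear_map_def by (blast intro: vec.linear_subspace_kernel)
  then have "vec.subspace (S \<inter> (\<Inter>x\<in>X. {y. \<beta> x y = 0}))"
    using assms(1) by (intro vec.subspace_inter vec.subspace_Inter) auto
  moreover have "S \<inter> (\<Inter>x\<in>X. {y. \<beta> x y = 0}) = {y\<in>S. \<forall>x\<in>X. \<beta> x y = 0}" by auto
  ultimately show ?thesis by simp
qed

lemma subset_setsum_left:
  fixes A B :: "'g::monoid_add set"
  shows "0 \<in> B \<Longrightarrow> A \<subseteq> setsum A B"
  unfolding setsum_def by force

lemma subset_setsum_right:
  fixes A B :: "'g::monoid_add set"
  shows "0 \<in> A \<Longrightarrow> B \<subseteq> setsum A B"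
  unfolding setsum_def by force

lemma exists_dependency_if_sum_of_right_kernels_ne:
  fixes \<beta> :: "'a::field ^ 'n \<Rightarrow> 'a ^ 'n \<Rightarrow> 'a ^ 'r"
  assumes S: "vec.subspace S" and \<beta>: "bilinear_map \<beta>"
    and ne: "setsum {y\<in>S. \<forall>x\<in>set xs. \<beta> x y = 0} {y\<in>S. \<forall>x\<in>set ys. \<beta> x y = 0} \<noteq> S"
  shows "\<exists>ls ms. length ls = length xs \<and> length ms = length ys \<and> (\<exists>i<length xs. ls ! i \<noteq> 0) \<and>
    (\<forall>y\<in>S. lin_comb_tuple ls \<beta> xs y = lin_comb_tuple ms \<beta> ys y)"
proof -
  let ?Ux = "{y\<in>S. \<forall>x\<in>set xs. \<beta> x y = 0}" and ?Uy = "{y\<in>S. \<forall>x\<in>set ys. \<beta> x y = 0}"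
  have Ux: "vec.subspace ?Ux" and Uy: "vec.subspace ?Uy"
    using subspace_right_kernel[OF S \<beta>] by auto
  have M: "vec.subspace (setsum ?Ux ?Uy)"
    unfolding setsum_def by (rule vec.subspace_sums[OF Ux Uy])
  moreover have "setsum ?Ux ?Uy \<subseteq> S"
    using S by (auto simp: setsum_def intro: vec.subspace_add)
  ultimately obtain z where z: "z \<in> S" "z \<notin> setsum ?Ux ?Uy" using ne by blast
  then obtain \<phi> where \<phi>: "linear_functional \<phi>" "\<phi> z \<noteq> 0" "\<forall>y\<in>setsum ?Ux ?Uy. \<phi> y = 0"
    using separating_linear_functional[OF M] by blast
  have "?Ux \<subseteq> setsum ?Ux ?Uy" "?Uy \<subseteq> setsum ?Ux ?Uy"
    using subset_setsum_left[OF vec.subspace_0[OF Uy]] subset_setsum_right[OF vec.subspace_0[OF Ux]] .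
  then have "\<forall>y\<in>S. (\<forall>x\<in>set xs. \<beta> x y = 0) \<longrightarrow> \<phi> y = 0"
    and "\<forall>y\<in>S. (\<forall>x\<in>set ys. \<beta> x y = 0) \<longrightarrow> \<phi> y = 0"
    using \<phi>(3) by blast+
  then obtain ls ms where
    ls: "length ls = length xs" "\<forall>y\<in>S. \<phi> y = lin_comb_tuple ls \<beta> xs y" and
    ms: "length ms = length ys" "\<forall>y\<in>S. \<phi> y = lin_comb_tuple ms \<beta> ys y"
    using vanishing_on_right_kernel_imp_lin_comb_tuple[OF S \<beta> \<phi>(1)] by (metis (no_types))
  have "\<exists>i<length xs. ls ! i \<noteq> 0"
  proof (rule ccontr)
    assume "\<not> (\<exists>i<length xs. ls ! i \<noteq> 0)"
    then have "lin_comb_tuple ls \<beta> xs z = 0" by (simp add: lin_comb_tuple_def lin_comb_form_def)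
    then show False using \<phi>(2) ls(2) z(1) by simp
  qed
  then show ?thesis using ls ms by (intro exI[of _ ls] exI[of _ ms]) auto
qed

lemma card_coset: "card (coset a V) = card (V :: 'g::ab_group_add set)"
  unfolding coset_def by (rule card_image) (simp add: inj_on_def)

lemma diff_mem_if_coset:
  assumes "vec.subspace V" and "x \<in> coset a V" and "x' \<in> coset a V"
  shows "x - x' \<in> V"
  using assms by (auto simp: coset_def vec.subspace_diff)

lemma inter_sect_zero_set:
  assumes "S \<subseteq> V" and "set xs \<subseteq> coset a V"
  shows "S \<inter> (\<Inter>x\<in>set xs. sect {(x, y). x \<in> coset a V \<and> y \<in> V \<and> \<beta> x y = 0} x)
    = {y\<in>S. \<forall>x\<in>set xs. \<beta> x y = 0}"
  using assms by (auto simp: sect_def)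

lemma card_dependent_tuples_le:
  fixes V S :: "('a::{field,finite} ^ 'n) set" and \<beta> :: "'a ^ 'n \<Rightarrow> 'a ^ 'n \<Rightarrow> 'a ^ 'r"
  assumes V: "vec.subspace V" and S: "vec.subspace S" and SV: "S \<subseteq> V"
    and \<beta>: "bilinear_map \<beta>" and rank: "bm_rank_ge V \<beta> s"
    and i: "i < k" and l: "ls ! i \<noteq> 0"
  shows "real (card {(xs, ys). length xs = k \<and> length ys = k \<and>
      set xs \<subseteq> coset a V \<and> set ys \<subseteq> coset a V \<and>
      (\<forall>y\<in>S. lin_comb_tuple ls \<beta> xs y = lin_comb_tuple ms \<beta> ys y)})
    \<le> real CARD('a) powr (real (vec.dim V - vec.dim S) - s) * real (card V) ^ (2 * k)"
    (is "real (card ?E) \<le> _")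
proof -
  let ?C = "coset a V" and ?T = "{xs. set xs \<subseteq> coset a V \<and> length xs = k}"
  let ?K = "{v\<in>V. \<forall>y\<in>S. lin_comb_form (ls ! i) \<beta> v y = 0}"
  have "xs ! i - t \<in> ?K" if e: "(xs, ys) \<in> ?E" and e': "(xs[i := t], ys) \<in> ?E" for xs t ys
  proof -
    have len: "i < length xs" using e i by simp
    then have "xs ! i \<in> set xs" "t \<in> set (xs[i := t])" by (simp_all add: set_update_memI)
    then have "xs ! i - t \<in> V" using e e' diff_mem_if_coset[OF V] by blast
    moreover have "\<forall>y\<in>S. lin_comb_tuple ls \<beta> (xs[i := t]) y = lin_comb_tuple ls \<beta> xs y"
      using e e' by auto
    ultimately show ?thesis using lin_comb_form_diff_eq_0_if_update_eq[OF \<beta> len] by blast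
  qed
  then have "card ?E \<le> card ?C ^ (k - 1) * card ?K * card ?T"
    by (intro card_tuples_le_by_coordinate_fibres[OF _ _ _ _ i])
      (auto simp: finite_lists_length_eq)
  also have "\<dots> = card V ^ (k - 1) * card ?K * card V ^ k"
    by (simp add: card_coset card_lists_length_eq)
  finally have "real (card ?E) \<le> real (card V) ^ (k - 1) * real (card ?K) * real (card V) ^ k"
    unfolding of_nat_mult[symmetric] of_nat_power[symmetric] of_nat_le_iff .
  also have "\<dots> \<le> real (card V) ^ (k - 1)
      * (real CARD('a) powr (real (vec.dim V - vec.dim S) - s) * real (card V)) * real (card V) ^ k"
    using card_left_kernel_le[OF V S SV linear_functional_lin_comb_form_left[OF \<beta>]
        linear_functional_lin_comb_form_right[OF \<beta>]] rank l
    by (intro mult_right_mono mult_left_mono) (auto simp: bm_rank_ge_def)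
  also have "\<dots> = real CARD('a) powr (real (vec.dim V - vec.dim S) - s)
      * (real (card V) ^ (k - 1) * real (card V) * real (card V) ^ k)"
    by (simp add: ac_simps)
  also have "real (card V) ^ (k - 1) * real (card V) * real (card V) ^ k = real (card V) ^ (2 * k)"
    using i power_minus_mult[of k "real (card V)"] by (simp add: mult_2 power_add)
  finally show ?thesis by simp
qed

lemma card_non_spanning_tuples_le:
  fixes V S :: "('a::{field,finite} ^ 'n) set" and \<beta> :: "'a ^ 'n \<Rightarrow> 'a ^ 'n \<Rightarrow> 'a ^ 'r"
  assumes V: "vec.subspace V" and S: "vec.subspace S" and SV: "S \<subseteq> V"
    and \<beta>: "bilinear_map \<beta>" and rank: "bm_rank_ge V \<beta> s"
  shows "real (card {(xs, ys). length xs = k \<and> length ys = k \<and>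
      set xs \<subseteq> coset a V \<and> set ys \<subseteq> coset a V \<and>
      setsum {y\<in>S. \<forall>x\<in>set xs. \<beta> x y = 0} {y\<in>S. \<forall>x\<in>set ys. \<beta> x y = 0} \<noteq> S})
    \<le> real CARD('a) powr (2 * real k * real CARD('r) + real (vec.dim V - vec.dim S) - s)
      * real (card V) ^ (2 * k)"
    (is "real (card ?Bad) \<le> _")
proof -
  let ?q = "real CARD('a)" and ?M = "real CARD('a) powr (real (vec.dim V - vec.dim S) - s) * real (card V) ^ (2 * k)"
  let ?L = "{ls :: ('a ^ 'r) list. set ls \<subseteq> UNIV \<and> length ls = k}"
  let ?W = "{(ls, ms). ls \<in> ?L \<and> ms \<in> ?L \<and> (\<exists>i<k. ls ! i \<noteq> 0)}"
  let ?Ev = "\<lambda>(ls, ms). {(xs, ys). length xs = k \<and> length ys = k \<and>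
      set xs \<subseteq> coset a V \<and> set ys \<subseteq> coset a V \<and>
      (\<forall>y\<in>S. lin_comb_tuple ls \<beta> xs y = lin_comb_tuple ms \<beta> ys y)}"
  have finL: "finite ?L" by (rule finite_lists_length_eq) simp
  have sub: "?W \<subseteq> ?L \<times> ?L" by auto
  have "?Bad \<subseteq> (\<Union>w\<in>?W. ?Ev w)"
  proof
    fix e assume "e \<in> ?Bad"
    then obtain xs ys where e: "e = (xs, ys)" "length xs = k" "length ys = k"
      and ne: "setsum {y\<in>S. \<forall>x\<in>set xs. \<beta> x y = 0} {y\<in>S. \<forall>x\<in>set ys. \<beta> x y = 0} \<noteq> S"
      by auto
    obtain ls ms where "(ls, ms) \<in> ?W" "\<forall>y\<in>S. lin_comb_tuple ls \<beta> xs y = lin_comb_tuple ms \<beta> ys y"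
      using exists_dependency_if_sum_of_right_kernels_ne[OF S \<beta> ne] e(2,3) by auto
    then show "e \<in> (\<Union>w\<in>?W. ?Ev w)" using \<open>e \<in> ?Bad\<close> e(1) by blast
  qed
  moreover have "finite (?Ev w)" for w
    by (rule finite_subset[of _ "{xs. set xs \<subseteq> coset a V \<and> length xs = k}
        \<times> {xs. set xs \<subseteq> coset a V \<and> length xs = k}"])
      (auto simp: finite_lists_length_eq split: prod.splits)
  moreover have "finite ?W" using finite_subset[OF sub] finL by blast
  ultimately have "real (card ?Bad) \<le> real (card ?W) * ?M"
    using card_dependent_tuples_le[OF V S SV \<beta> rank]
    by (intro card_le_card_mult_if_covered) auto
  also have "\<dots> \<le> real (card (?L \<times> ?L)) * ?M"
    using card_mono[OF finite_cartesian_product[OF finL finL] sub]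
    by (intro mult_right_mono of_nat_mono) simp_all
  also have "real (card (?L \<times> ?L)) = ?q ^ (2 * (CARD('r) * k))"
    using card_lists_length_eq[of "UNIV :: ('a ^ 'r) set" k]
    by (simp add: card_cartesian_product power_mult[symmetric] power_add[symmetric] mult_2)
  also have "\<dots> = ?q powr (2 * real k * real CARD('r))"
    by (simp add: powr_realpow[symmetric] ac_simps)
  also have "?q powr (2 * real k * real CARD('r)) * ?M
      = ?q powr (2 * real k * real CARD('r) + real (vec.dim V - vec.dim S) - s) * real (card V) ^ (2 * k)"
    by (simp only: mult.assoc[symmetric] powr_add[symmetric] add_diff_eq)
  finally show ?thesis .
qed

theorem lemma2p8:
  fixes p :: nat and r d k :: nat and s :: real
    and V S :: "('a::{field,finite} ^ 'n) set"
    and \<beta> :: "'a ^ 'n \<Rightarrow> 'a ^ 'n \<Rightarrow> 'a ^ 'r"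
    and a :: "'a ^ 'n"
  assumes "prime p" and "CARD('a) = p" and "CARD('r) = r"
    and "vec.subspace V"
    and "bilinear_map \<beta>"
    and "bm_rank_ge V \<beta> s"
    and "vec.subspace S" and "S \<subseteq> V" and "vec.dim V - vec.dim S = d"
    and "k > 0"
  shows "let B = {(x, y). x \<in> coset a V \<and> y \<in> V \<and> \<beta> x y = 0} in
    real (card {(xs, ys). length xs = k \<and> length ys = k \<and>
                  set xs \<subseteq> coset a V \<and> set ys \<subseteq> coset a V \<and>
                  setsum (S \<inter> (\<Inter>x\<in>set xs. sect B x)) (S \<inter> (\<Inter>y\<in>set ys. sect B y)) \<noteq> S})
      \<le> 81 * real p powr (2 * real d + 4 * real k * real r - s / 4) * real (card V) ^ (2 * k)"
proof -
  \<comment> \<open>Ranks are nonnegative, so the rank hypothesis also holds with max s 0; the resulting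
    bound p powr (2kr + d - max s 0) * card V ^ 2k implies the claim for every real s.\<close>
  let ?e = "2 * real k * real r + real d - max s 0"
    and ?e' = "2 * real d + 4 * real k * real r - s / 4"
  have "bm_rank_ge V \<beta> (max s 0)"
    using assms(6) by (auto simp: bm_rank_ge_def)
  note card_bound =
    card_non_spanning_tuples_le[OF assms(4,7,8,5) this, of k a, unfolded assms(2,3,9)]
  have "real p powr ?e \<le> 81 * real p powr ?e'"
  proof -
    have "0 \<le> real k * real r" "s \<le> max s 0" "0 \<le> max s 0" by simp_all
    then have "?e \<le> ?e'" by linarith
    moreover have "1 \<le> real p" using assms(1) prime_ge_1_nat by simp
    ultimately have "real p powr ?e \<le> real p powr ?e'" by (rule powr_mono)
    then show ?thesis using powr_ge_zero[of "real p" ?e'] by linarith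
  qed
  then have "real p powr ?e * real (card V) ^ (2 * k) \<le> 81 * real p powr ?e' * real (card V) ^ (2 * k)"
    by (intro mult_right_mono) auto
  then show ?thesis
    unfolding Let_def using order_trans[OF card_bound]
    by (simp add: inter_sect_zero_set[OF assms(8)] cong: conj_cong)
qed

end
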